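(* Let $n\geq 2$ and let $S$ be a semigroup which is the union of $n$ minimal left ideals. Then $\operatorname{Aut}(\Gamma(S))\cong S_n$, where $S_n$ is the symmetric group of degree $n$. Moreover, $|\operatorname{Aut}(\Gamma(S))|=n!$.
   Context: A left ideal of a semigroup $S$ is a non-empty subset $I\subseteq S$ with $SI\subseteq I$; it is nontrivial if $I\neq S$. The intersection of two left ideals is nontrivial if it is non-empty. Minimal left ideals are understood to be nontrivial: a nontrivial left ideal is minimal if it does not properly contain any left ideal of $S$. The intersection ideal graph $\Gamma(S)$ is the simple undirected graph whose vertices are the nontrivial left ideals of $S$, with two distinct vertices $I,J$ adjacent if and only if $I\cap J$ is nontrivial. "Union of $n$ minimal left ideals" means the union of $n$ pairwise distinct minimal left ideals. $\operatorname{Aut}(\Gamma)$ is the group, under composition, of permutations of the vertex set of $\Gamma$ preserving adjacency and non-adjacency. *)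

theory Defs
  imports "HOL-Algebra.Sym_Groups" "Graph_Theory.Pair_Digraph"
begin

text \<open>The semigroup \<open>S\<close> is the universe of a type of class \<open>semigroup_mult\<close>.\<close>

definition left_ideal :: "'a::semigroup_mult set \<Rightarrow> bool" where
  "left_ideal I \<longleftrightarrow> I \<noteq> {} \<and> (\<forall>s. \<forall>x\<in>I. s * x \<in> I)"

definition nontrivial_left_ideal :: "'a::semigroup_mult set \<Rightarrow> bool" where
  "nontrivial_left_ideal I \<longleftrightarrow> left_ideal I \<and> I \<noteq> UNIV"

definition minimal_left_ideal :: "'a::semigroup_mult set \<Rightarrow> bool" where
  "minimal_left_ideal I \<longleftrightarrow> nontrivial_left_ideal I \<and> \<not> (\<exists>J. left_ideal J \<and> J \<subset> I)"

text \<open>A simple undirected graph is represented by a pair digraph whose arc set is symmetric and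
  irreflexive: both orientations of each edge are arcs.\<close>

definition intersection_ideal_graph :: "'a::semigroup_mult set pair_pre_digraph" where
  "intersection_ideal_graph =
    \<lparr>pverts = {I. nontrivial_left_ideal I},
     parcs = {(I, J). nontrivial_left_ideal I \<and> nontrivial_left_ideal J \<and> I \<noteq> J \<and> I \<inter> J \<noteq> {}}\<rparr>"

lemma sym_parcs_intersection_ideal_graph: "sym (parcs intersection_ideal_graph)"
  by (auto simp: intersection_ideal_graph_def sym_def)

lemma irrefl_parcs_intersection_ideal_graph: "irrefl (parcs intersection_ideal_graph)"
  by (auto simp: intersection_ideal_graph_def irrefl_def)

text \<open>As in \<^const>\<open>sym_group\<close>, a permutation of the vertex set is a function on the whole type that
  fixes everything outside the vertex set.\<close>

definition graph_automorphism :: "'v pair_pre_digraph \<Rightarrow> ('v \<Rightarrow> 'v) \<Rightarrow> bool" where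
  "graph_automorphism G p \<longleftrightarrow> p permutes pverts G \<and>
     (\<forall>u\<in>pverts G. \<forall>v\<in>pverts G. (p u, p v) \<in> parcs G \<longleftrightarrow> (u, v) \<in> parcs G)"

definition Aut :: "'v pair_pre_digraph \<Rightarrow> ('v \<Rightarrow> 'v) monoid" where
  "Aut G = \<lparr>carrier = {p. graph_automorphism G p}, mult = (\<circ>), one = id\<rparr>"

lemma group_Aut: "group (Aut G)"
proof (rule groupI)
  fix p q assume "p \<in> carrier (Aut G)" "q \<in> carrier (Aut G)"
  then show "p \<otimes>\<^bsub>Aut G\<^esub> q \<in> carrier (Aut G)"
    by (auto simp: Aut_def graph_automorphism_def permutes_compose permutes_in_image)
next
  fix p assume "p \<in> carrier (Aut G)"
  then have p: "p permutes pverts G"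
    and pe: "\<forall>u\<in>pverts G. \<forall>v\<in>pverts G. (p u, p v) \<in> parcs G \<longleftrightarrow> (u, v) \<in> parcs G"
    by (auto simp: Aut_def graph_automorphism_def)
  have "inv_into UNIV p permutes pverts G" using p by (rule permutes_inv)
  moreover from this have "(inv_into UNIV p u, inv_into UNIV p v) \<in> parcs G \<longleftrightarrow> (u, v) \<in> parcs G"
    if "u \<in> pverts G" "v \<in> pverts G" for u v
    using that pe p by (metis permutes_in_image permutes_inverses(1))
  ultimately have "inv_into UNIV p \<in> carrier (Aut G)"
    by (auto simp: Aut_def graph_automorphism_def)
  then show "\<exists>q\<in>carrier (Aut G). q \<otimes>\<^bsub>Aut G\<^esub> p = \<one>\<^bsub>Aut G\<^esub>"
    using permutes_inv_o(2)[OF p] by (auto simp: Aut_def)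
qed (auto simp: Aut_def graph_automorphism_def comp_assoc permutes_id)

end

theory Submission
  imports Defs
begin

text \<open>A left ideal meeting a minimal left ideal contains it. Hence, if the minimal left ideals
  cover \<open>S\<close>, taking unions is a bijection from the nonempty proper sets of minimal left ideals onto
  the nontrivial left ideals, and complements of nontrivial left ideals are left ideals. Distinct
  vertices are non-adjacent iff they are disjoint, and \<open>I \<subseteq> J\<close> iff every vertex disjoint from
  \<open>J\<close> is disjoint from \<open>I\<close>; so an automorphism preserves inclusion, permutes the minimal left
  ideals, and is determined by this permutation. Conversely every permutation of the minimal left
  ideals extends to unions.\<close>

section \<open>Symmetric groups on arbitrary sets\<close>

definition Sym :: "'b set \<Rightarrow> ('b \<Rightarrow> 'b) monoid" where
  "Sym A = \<lparr>carrier = {p. p permutes A}, mult = (\<circ>), one = id\<rparr>"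

text \<open>Conjugation with \<open>f\<close>, continued by the identity outside \<open>B\<close>,
  is the isomorphism. It serves in the end to number the minimal left ideals by
  \<open>{1..n}\<close>.\<close>

lemma Sym_is_iso:
  assumes f: "bij_betw f A B"
  shows "Sym A \<cong> Sym B"
proof -
  let ?h = "\<lambda>\<pi> x. if x \<in> B then f (\<pi> (inv_into A f x)) else x"
  have bij: "bij_betw ?h {\<pi>. \<pi> permutes A} {\<pi>. \<pi> permutes B}"
    by (rule bij_betw_permutations[OF f])
  have comp: "?h (\<pi> \<circ> \<sigma>) = ?h \<pi> \<circ> ?h \<sigma>" if "\<sigma> permutes A" for \<pi> \<sigma>
  proof
    fix x
    show "?h (\<pi> \<circ> \<sigma>) x = (?h \<pi> \<circ> ?h \<sigma>) x"
    proof (cases "x \<in> B")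
      case True
      then have "\<sigma> (inv_into A f x) \<in> A"
        using f that by (metis bij_betw_def inv_into_into permutes_in_image)
      then show ?thesis
        using True f bij_betwE[OF f] by (simp add: bij_betw_inv_into_left)
    qed simp
  qed
  have "?h \<in> iso (Sym A) (Sym B)"
  proof (rule isoI, rule homI)
    fix \<pi> \<sigma> assume "\<pi> \<in> carrier (Sym A)" "\<sigma> \<in> carrier (Sym A)"
    then show "?h (\<pi> \<otimes>\<^bsub>Sym A\<^esub> \<sigma>) = ?h \<pi> \<otimes>\<^bsub>Sym B\<^esub> ?h \<sigma>"
      using comp[of \<sigma> \<pi>] by (simp only: Sym_def monoid.simps partial_object.simps mem_Collect_eq)
  next
    fix \<pi> assume "\<pi> \<in> carrier (Sym A)"
    then show "?h \<pi> \<in> carrier (Sym B)"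
      using bij_betw_apply[OF bij, of \<pi>] by (simp only: Sym_def partial_object.simps)
  next
    show "bij_betw ?h (carrier (Sym A)) (carrier (Sym B))"
      using bij by (simp only: Sym_def partial_object.simps)
  qed
  then show ?thesis by (rule is_isoI)
qed

lemma Sym_atLeast1_eq_sym_group: "Sym {1..n} = sym_group n"
  by (simp add: Sym_def sym_group_def)

lemma order_sym_group: "order (sym_group n) = fact n"
  using card_permutations[of "{1..n}" n] by (simp add: order_def sym_group_def)

section \<open>Left ideals and disjointness\<close>

lemma left_ideal_Int:
  assumes "left_ideal I" "left_ideal J" "I \<inter> J \<noteq> {}"
  shows "left_ideal (I \<inter> J)"
  using assms by (auto simp: left_ideal_def)

lemma left_ideal_Union:
  assumes "\<And>I. I \<in> \<A> \<Longrightarrow> left_ideal I" "\<A> \<noteq> {}"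
  shows "left_ideal (\<Union>\<A>)"
  using assms unfolding left_ideal_def by blast

text \<open>The nonempty set \<open>I \<inter> J\<close> is itself a left ideal inside
  \<open>I\<close>, so minimality leaves only \<open>I \<inter> J = I\<close>.\<close>

lemma minimal_left_ideal_subset:
  assumes I: "minimal_left_ideal I" and J: "left_ideal J" and "I \<inter> J \<noteq> {}"
  shows "I \<subseteq> J"
proof -
  have "left_ideal (I \<inter> J)"
    using assms by (intro left_ideal_Int)
      (auto simp: minimal_left_ideal_def nontrivial_left_ideal_def)
  then have "\<not> I \<inter> J \<subset> I"
    using I by (auto simp: minimal_left_ideal_def)
  then show ?thesis by blast
qed

abbreviation vertices :: "'a::semigroup_mult set set" where
  "vertices \<equiv> {I. nontrivial_left_ideal I}"

lemma pverts_intersection_ideal_graph: "pverts intersection_ideal_graph = vertices"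
  by (simp add: intersection_ideal_graph_def)

text \<open>For distinct vertices, adjacency is the negation of disjointness. A vertex paired with
  itself is neither adjacent nor disjoint, because it is nonempty; injectivity of \<open>p\<close>
  keeps the two cases apart.\<close>

lemma graph_automorphism_iff_disjnt:
  "graph_automorphism intersection_ideal_graph p \<longleftrightarrow>
     p permutes vertices \<and> (\<forall>I\<in>vertices. \<forall>J\<in>vertices. disjnt (p I) (p J) \<longleftrightarrow> disjnt I J)"
proof (cases "p permutes vertices")
  case True
  have arc: "(I, J) \<in> parcs intersection_ideal_graph \<longleftrightarrow> I \<noteq> J \<and> \<not> disjnt I J"
    if "I \<in> vertices" "J \<in> vertices" for I J :: "'a set"
    using that by (simp add: intersection_ideal_graph_def disjnt_def)
  have nd: "\<not> disjnt I I" if "I \<in> vertices" for I :: "'a set"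
    using that by (simp add: nontrivial_left_ideal_def left_ideal_def)
  have pv: "p I \<in> vertices" if "I \<in> vertices" for I
    using permutes_in_image[OF True] that by blast
  have inj: "p I = p J \<longleftrightarrow> I = J" for I J
    using permutes_inj[OF True] by (simp add: inj_eq)
  have "((p I, p J) \<in> parcs intersection_ideal_graph \<longleftrightarrow> (I, J) \<in> parcs intersection_ideal_graph)
      \<longleftrightarrow> (disjnt (p I) (p J) \<longleftrightarrow> disjnt I J)"
    if "I \<in> vertices" "J \<in> vertices" for I J
    using nd[OF that(1)] nd[OF pv[OF that(1)]]
    unfolding arc[OF that] arc[OF pv[OF that(1)] pv[OF that(2)]] inj by (cases "I = J") simp_all
  then show ?thesis
    using True by (simp add: graph_automorphism_def pverts_intersection_ideal_graph)
qed (simp add: graph_automorphism_def pverts_intersection_ideal_graph)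

section \<open>Left ideals as unions of minimal ones\<close>

locale minimal_left_ideal_cover =
  fixes \<M> :: "'a::semigroup_mult set set"
  assumes minimal: "I \<in> \<M> \<Longrightarrow> minimal_left_ideal I"
    and covers: "\<Union>\<M> = UNIV"
begin

definition parts :: "'a set \<Rightarrow> 'a set set" where
  "parts I = {M \<in> \<M>. M \<subseteq> I}"

text \<open>The second branch makes \<open>extend q\<close> fix every non-vertex, as
  \<open>permutes\<close> demands.\<close>

definition extend :: "('a set \<Rightarrow> 'a set) \<Rightarrow> 'a set \<Rightarrow> 'a set" where
  "extend q I = (if I \<in> vertices then \<Union>(q ` parts I) else I)"

lemma member_vertex: "M \<in> \<M> \<Longrightarrow> M \<in> vertices"
  using minimal by (simp add: minimal_left_ideal_def)

lemma member_left_ideal: "M \<in> \<M> \<Longrightarrow> left_ideal M"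
  using member_vertex by (simp add: nontrivial_left_ideal_def)

lemma member_nonempty: "M \<in> \<M> \<Longrightarrow> M \<noteq> {}"
  using member_left_ideal by (simp add: left_ideal_def)

lemma member_subset: "M \<in> \<M> \<Longrightarrow> left_ideal J \<Longrightarrow> x \<in> M \<Longrightarrow> x \<in> J \<Longrightarrow> M \<subseteq> J"
  using minimal_left_ideal_subset[OF minimal] by blast

lemma member_unique: "M \<in> \<M> \<Longrightarrow> N \<in> \<M> \<Longrightarrow> x \<in> M \<Longrightarrow> x \<in> N \<Longrightarrow> M = N"
  by (meson member_left_ideal member_subset subset_antisym)

text \<open>Each point of \<open>I\<close> lies in some member of \<open>\<M>\<close>; that member
  meets \<open>I\<close> and hence lies inside it.\<close>

lemma Union_parts:
  assumes "left_ideal I"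
  shows "\<Union>(parts I) = I"
proof
  show "I \<subseteq> \<Union>(parts I)"
  proof
    fix x assume "x \<in> I"
    moreover obtain M where "M \<in> \<M>" "x \<in> M" using covers by blast
    ultimately show "x \<in> \<Union>(parts I)"
      using member_subset[OF _ assms] by (auto simp: parts_def)
  qed
qed (auto simp: parts_def)

text \<open>Members are nonempty and pairwise disjoint, so a member inside
  \<open>\<Union>\<A>\<close> shares a point with, and thus equals, one in \<open>\<A>\<close>. In
  particular \<open>\<Union>\<close> is injective on subsets of \<open>\<M>\<close>.\<close>

lemma parts_Union:
  assumes "\<A> \<subseteq> \<M>"
  shows "parts (\<Union>\<A>) = \<A>"
proof
  show "parts (\<Union>\<A>) \<subseteq> \<A>"
  proof
    fix M assume "M \<in> parts (\<Union>\<A>)"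
    then have M: "M \<in> \<M>" "M \<subseteq> \<Union>\<A>" by (auto simp: parts_def)
    then obtain x N where "x \<in> M" "N \<in> \<A>" "x \<in> N" using member_nonempty by blast
    then show "M \<in> \<A>" using member_unique M(1) assms by blast
  qed
qed (use assms in \<open>auto simp: parts_def\<close>)

lemma parts_member: "M \<in> \<M> \<Longrightarrow> parts M = {M}"
  using parts_Union[of "{M}"] by simp

lemma parts_vertex:
  assumes "I \<in> vertices"
  shows "parts I \<subseteq> \<M>" "parts I \<noteq> {}" "parts I \<noteq> \<M>"
proof -
  have "\<Union>(parts I) = I" "I \<noteq> {}" "I \<noteq> UNIV"
    using assms Union_parts by (auto simp: nontrivial_left_ideal_def left_ideal_def)
  then show "parts I \<noteq> {}" "parts I \<noteq> \<M>" using covers by auto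
qed (auto simp: parts_def)

lemma Union_vertex:
  assumes "\<A> \<subseteq> \<M>" "\<A> \<noteq> {}" "\<A> \<noteq> \<M>"
  shows "\<Union>\<A> \<in> vertices"
proof -
  have "left_ideal (\<Union>\<A>)"
    using assms member_left_ideal by (intro left_ideal_Union) auto
  \<comment> \<open>Otherwise \<open>\<A>\<close> and \<open>\<M>\<close> would have the same union,
    and applying \<open>parts\<close> would identify them.\<close>
  moreover have "\<Union>\<A> \<noteq> UNIV"
    using parts_Union[OF assms(1)] parts_Union[of \<M>] covers assms(3) by auto
  ultimately show ?thesis by (simp add: nontrivial_left_ideal_def)
qed

text \<open>If \<open>s * x \<in> I\<close> and \<open>x\<close> lies in the member
  \<open>M\<close>, then \<open>s * x \<in> M\<close> too, so \<open>M\<close> meets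
  \<open>I\<close>; hence \<open>M \<subseteq> I\<close> and \<open>x \<in> I\<close>.\<close>

lemma Compl_vertex:
  fixes I :: "'a set"
  assumes "I \<in> vertices"
  shows "- I \<in> vertices"
proof -
  have I: "left_ideal I" "I \<noteq> {}" "I \<noteq> UNIV"
    using assms by (auto simp: nontrivial_left_ideal_def left_ideal_def)
  have "s * x \<notin> I" if "x \<notin> I" for s x
  proof
    assume "s * x \<in> I"
    moreover obtain M where M: "M \<in> \<M>" "x \<in> M" using covers by blast
    moreover have "s * x \<in> M" using M member_left_ideal by (simp add: left_ideal_def)
    ultimately show False using member_subset[OF M(1) I(1)] that by blast
  qed
  then show ?thesis using I by (auto simp: nontrivial_left_ideal_def left_ideal_def)
qed

text \<open>Moves the question from sets of elements to sets of members, where an injective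
  \<open>q\<close> visibly preserves disjointness.\<close>

lemma disjnt_iff_parts:
  assumes "I \<in> vertices" "J \<in> vertices"
  shows "disjnt I J \<longleftrightarrow> disjnt (parts I) (parts J)"
proof -
  have "left_ideal I" "left_ideal J"
    using assms by (auto simp: nontrivial_left_ideal_def)
  then have *: "\<Union>(parts I) = I" "\<Union>(parts J) = J" by (simp_all add: Union_parts)
  have "M = N" if "M \<in> parts I" "N \<in> parts J" "x \<in> M" "x \<in> N" for M N x
    using that member_unique by (auto simp: parts_def)
  moreover have "M \<noteq> {}" if "M \<in> parts I" for M
    using that member_nonempty by (auto simp: parts_def)
  ultimately show ?thesis
    unfolding disjnt_iff by (metis * UnionE UnionI all_not_in_conv)
qed

section \<open>From permutations of the minimal left ideals to automorphisms\<close>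

lemma image_parts:
  assumes "q permutes \<M>" "I \<in> vertices"
  shows "q ` parts I \<subseteq> \<M>" "q ` parts I \<noteq> {}" "q ` parts I \<noteq> \<M>"
proof -
  show "q ` parts I \<subseteq> \<M>" "q ` parts I \<noteq> {}"
    using parts_vertex[OF assms(2)] permutes_image[OF assms(1)] by auto
  show "q ` parts I \<noteq> \<M>"
    using parts_vertex(3)[OF assms(2)] permutes_image[OF assms(1)] permutes_inj[OF assms(1)]
    by (metis inj_image_eq_iff)
qed

lemma extend_vertex: "q permutes \<M> \<Longrightarrow> I \<in> vertices \<Longrightarrow> extend q I \<in> vertices"
  using Union_vertex[OF image_parts] by (simp add: extend_def)

lemma parts_extend: "q permutes \<M> \<Longrightarrow> I \<in> vertices \<Longrightarrow> parts (extend q I) = q ` parts I"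
  using parts_Union[OF image_parts(1)] by (simp add: extend_def)

lemma extend_member: "M \<in> \<M> \<Longrightarrow> extend q M = q M"
  using member_vertex by (simp add: extend_def parts_member)

lemma extend_id: "extend id = id"
  using Union_parts by (intro ext) (simp add: extend_def nontrivial_left_ideal_def)

lemma extend_comp:
  assumes "r permutes \<M>"
  shows "extend (q \<circ> r) = extend q \<circ> extend r"
proof
  fix I
  show "extend (q \<circ> r) I = (extend q \<circ> extend r) I"
  proof (cases "I \<in> vertices")
    case True
    have "extend q (extend r I) = \<Union>(q ` r ` parts I)"
      using extend_vertex[OF assms True] by (simp add: extend_def[of q] parts_extend[OF assms True])
    then show ?thesis
      using True by (simp add: extend_def[of "q \<circ> r"] image_image)
  qed (simp add: extend_def)
qed

lemma extend_permutes:
  assumes "q permutes \<M>"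
  shows "extend q permutes vertices"
proof (rule bij_imp_permutes)
  let ?q' = "inv_into UNIV q"
  have q': "?q' permutes \<M>" by (rule permutes_inv[OF assms])
  \<comment> \<open>Since \<open>extend\<close> respects composition and identity, extending the
    inverse of \<open>q\<close> inverts \<open>extend q\<close>.\<close>
  have "extend ?q' \<circ> extend q = id" "extend q \<circ> extend ?q' = id"
    using extend_comp[OF assms, of ?q'] extend_comp[OF q', of q]
    by (simp_all add: permutes_inv_o[OF assms] extend_id)
  then have "extend ?q' (extend q I) = I" "extend q (extend ?q' I) = I" for I
    by (metis comp_apply id_apply)+
  then show "bij_betw (extend q) vertices vertices"
    using extend_vertex[OF assms] extend_vertex[OF q']
    by (intro bij_betw_byWitness[where f' = "extend ?q'"]) blast+
qed (simp add: extend_def)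

lemma extend_automorphism:
  assumes q: "q permutes \<M>"
  shows "graph_automorphism intersection_ideal_graph (extend q)"
proof -
  have "disjnt (extend q I) (extend q J) \<longleftrightarrow> disjnt I J"
    if IJ: "I \<in> vertices" "J \<in> vertices" for I J
  proof -
    have "disjnt (extend q I) (extend q J) \<longleftrightarrow> disjnt (q ` parts I) (q ` parts J)"
      unfolding disjnt_iff_parts[OF extend_vertex[OF q IJ(1)] extend_vertex[OF q IJ(2)]]
        parts_extend[OF q IJ(1)] parts_extend[OF q IJ(2)] ..
    also have "\<dots> \<longleftrightarrow> disjnt (parts I) (parts J)"
      using image_Int[OF permutes_inj[OF q], of "parts I" "parts J"] by (auto simp: disjnt_def)
    finally show ?thesis using disjnt_iff_parts[OF IJ] by simp
  qed
  then show ?thesis using extend_permutes[OF q] by (simp add: graph_automorphism_iff_disjnt)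
qed

section \<open>From automorphisms to permutations of the minimal left ideals\<close>

lemma subset_iff_disjnt:
  fixes I J :: "'a set"
  assumes "J \<in> vertices"
  shows "I \<subseteq> J \<longleftrightarrow> (\<forall>K\<in>vertices. disjnt J K \<longrightarrow> disjnt I K)"
proof
  assume "\<forall>K\<in>vertices. disjnt J K \<longrightarrow> disjnt I K"
  \<comment> \<open>Take \<open>K = - J\<close>, which is a vertex disjoint from
    \<open>J\<close>.\<close>
  then have "disjnt I (- J)"
    using Compl_vertex[OF assms] by (auto simp: disjnt_iff)
  then show "I \<subseteq> J" by (auto simp: disjnt_iff)
qed (auto simp: disjnt_iff)

text \<open>Describes \<open>\<M>\<close> by inclusion among vertices alone, which automorphisms
  will be seen to preserve. For the converse, a minimal vertex contains some member and so coincides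
  with it.\<close>

lemma mem_iff_minimal_vertex:
  "I \<in> \<M> \<longleftrightarrow> I \<in> vertices \<and> (\<forall>J\<in>vertices. J \<subseteq> I \<longrightarrow> J = I)"
proof
  assume "I \<in> \<M>"
  then show "I \<in> vertices \<and> (\<forall>J\<in>vertices. J \<subseteq> I \<longrightarrow> J = I)"
    using minimal by (auto simp: minimal_left_ideal_def nontrivial_left_ideal_def)
next
  assume I: "I \<in> vertices \<and> (\<forall>J\<in>vertices. J \<subseteq> I \<longrightarrow> J = I)"
  then obtain M where "M \<in> parts I" using parts_vertex(2) by blast
  then have "M \<in> \<M>" "M \<subseteq> I" by (auto simp: parts_def)
  then show "I \<in> \<M>" using I member_vertex by blast
qed

context
  fixes p :: "'a set \<Rightarrow> 'a set"
  assumes p: "graph_automorphism intersection_ideal_graph p"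
begin

lemma automorphism_permutes: "p permutes vertices"
  using p by (simp add: graph_automorphism_iff_disjnt)

lemma automorphism_vertex_iff: "p I \<in> vertices \<longleftrightarrow> I \<in> vertices"
  by (rule permutes_in_image[OF automorphism_permutes])

text \<open>Reindexing along \<open>p\<close>: this transports the quantified descriptions of
  inclusion and of minimality from \<open>I\<close> to \<open>p I\<close>.\<close>

lemma ball_vertices_automorphism: "(\<forall>K\<in>vertices. P K) \<longleftrightarrow> (\<forall>K\<in>vertices. P (p K))"
  using ball_simps(9)[of p vertices P] permutes_image[OF automorphism_permutes] by simp

lemma automorphism_subset_iff:
  assumes "I \<in> vertices" "J \<in> vertices"
  shows "p I \<subseteq> p J \<longleftrightarrow> I \<subseteq> J"
proof -
  have disj: "disjnt (p K) (p L) \<longleftrightarrow> disjnt K L" if "K \<in> vertices" "L \<in> vertices" for K L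
    using p that by (simp add: graph_automorphism_iff_disjnt)
  have "p I \<subseteq> p J \<longleftrightarrow> (\<forall>K\<in>vertices. disjnt (p J) K \<longrightarrow> disjnt (p I) K)"
    using assms(2) by (intro subset_iff_disjnt) (simp only: automorphism_vertex_iff)
  also have "\<dots> \<longleftrightarrow> (\<forall>K\<in>vertices. disjnt (p J) (p K) \<longrightarrow> disjnt (p I) (p K))"
    by (rule ball_vertices_automorphism)
  also have "\<dots> \<longleftrightarrow> I \<subseteq> J"
    unfolding subset_iff_disjnt[OF assms(2)] using disj assms by blast
  finally show ?thesis .
qed

lemma automorphism_mem_iff: "p I \<in> \<M> \<longleftrightarrow> I \<in> \<M>"
proof (cases "I \<in> vertices")
  case True
  have "p I \<in> \<M> \<longleftrightarrow> (\<forall>J\<in>vertices. J \<subseteq> p I \<longrightarrow> J = p I)"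
    unfolding mem_iff_minimal_vertex automorphism_vertex_iff using True by blast
  also have "\<dots> \<longleftrightarrow> (\<forall>J\<in>vertices. p J \<subseteq> p I \<longrightarrow> p J = p I)"
    by (rule ball_vertices_automorphism)
  also have "\<dots> \<longleftrightarrow> (\<forall>J\<in>vertices. J \<subseteq> I \<longrightarrow> J = I)"
    by (intro ball_cong refl)
      (simp only: automorphism_subset_iff[OF _ True] inj_eq[OF permutes_inj[OF automorphism_permutes]])
  also have "\<dots> \<longleftrightarrow> I \<in> \<M>"
    unfolding mem_iff_minimal_vertex using True by blast
  finally show ?thesis .
next
  case False
  then show ?thesis using automorphism_vertex_iff member_vertex by blast
qed

text \<open>The case distinction is there because \<open>p\<close> may move vertices outside
  \<open>\<M>\<close>, while a permutation of \<open>\<M>\<close> has to fix them.\<close>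

lemma restriction_permutes: "(\<lambda>M. if M \<in> \<M> then p M else M) permutes \<M>"
proof (rule bij_imp_permutes)
  have "p ` \<M> = \<M>"
  proof
    show "\<M> \<subseteq> p ` \<M>"
    proof
      fix M assume "M \<in> \<M>"
      moreover obtain N where "M = p N"
        using permutes_surj[OF automorphism_permutes] by (metis surjD)
      ultimately show "M \<in> p ` \<M>" by (simp only: automorphism_mem_iff imageI)
    qed
  qed (simp add: image_subset_iff automorphism_mem_iff)
  then have "bij_betw p \<M> \<M>"
    using permutes_inj_on[OF automorphism_permutes] by (simp only: bij_betw_def)
  then show "bij_betw (\<lambda>M. if M \<in> \<M> then p M else M) \<M> \<M>"
    by (simp cong: bij_betw_cong)
qed simp

text \<open>Gives surjectivity of \<open>extend\<close>. As \<open>p\<close> preserves inclusion and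
  membership in \<open>\<M>\<close> in both directions, it maps the parts of \<open>I\<close> onto
  those of \<open>p I\<close>, whose union is \<open>p I\<close>.\<close>

lemma extend_restriction: "extend (\<lambda>M. if M \<in> \<M> then p M else M) = p"
proof
  fix I
  let ?q = "\<lambda>M. if M \<in> \<M> then p M else M"
  show "extend ?q I = p I"
  proof (cases "I \<in> vertices")
    case True
    have "parts (p I) = ?q ` parts I"
    proof
      show "parts (p I) \<subseteq> ?q ` parts I"
      proof
        fix N assume "N \<in> parts (p I)"
        moreover from this obtain M where "N = p M"
          using permutes_surj[OF automorphism_permutes] by (metis surjD)
        ultimately have "N = p M" "M \<in> \<M>" "p M \<subseteq> p I"
          using automorphism_mem_iff by (auto simp: parts_def)
        then show "N \<in> ?q ` parts I"
          using automorphism_subset_iff[OF member_vertex True] by (auto simp: parts_def)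
      qed
      show "?q ` parts I \<subseteq> parts (p I)"
        using automorphism_mem_iff automorphism_subset_iff[OF member_vertex True]
        by (auto simp: parts_def)
    qed
    moreover have "left_ideal (p I)"
      using True automorphism_vertex_iff[of I] by (simp add: nontrivial_left_ideal_def)
    ultimately show ?thesis
      using True Union_parts[of "p I"] by (simp add: extend_def)
  next
    case False
    then show ?thesis using permutes_not_in[OF automorphism_permutes] by (simp add: extend_def)
  qed
qed

end

section \<open>The isomorphism\<close>

lemma inj_on_extend: "inj_on extend {q. q permutes \<M>}"
proof (rule inj_onI)
  fix q r assume qr: "q \<in> {q. q permutes \<M>}" "r \<in> {q. q permutes \<M>}" "extend q = extend r"
  show "q = r"
  proof
    fix M
    show "q M = r M"
      \<comment> \<open>On members, \<open>extend q\<close> and \<open>extend r\<close> return the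
        values of \<open>q\<close> and \<open>r\<close>; elsewhere both permutations are the
        identity.\<close>
      using qr extend_member[of M q] extend_member[of M r]
      by (cases "M \<in> \<M>") (auto simp: permutes_not_in)
  qed
qed

lemma Sym_iso_Aut: "Sym \<M> \<cong> Aut (intersection_ideal_graph :: 'a set pair_pre_digraph)"
proof -
  let ?G = "intersection_ideal_graph :: 'a set pair_pre_digraph"
  have "extend \<in> hom (Sym \<M>) (Aut ?G)"
    by (rule homI) (simp_all add: Sym_def Aut_def extend_automorphism extend_comp)
  moreover have "extend ` {q. q permutes \<M>} = {p. graph_automorphism ?G p}"
  proof
    show "{p. graph_automorphism ?G p} \<subseteq> extend ` {q. q permutes \<M>}"
    proof
      fix p :: "'a set \<Rightarrow> 'a set"
      assume "p \<in> {p. graph_automorphism ?G p}"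
      then have p: "graph_automorphism ?G p" by simp
      show "p \<in> extend ` {q. q permutes \<M>}"
        by (rule image_eqI, rule extend_restriction[OF p, symmetric])
          (simp only: mem_Collect_eq restriction_permutes[OF p])
    qed
  qed (simp add: image_subset_iff extend_automorphism)
  then have "bij_betw extend (carrier (Sym \<M>)) (carrier (Aut ?G))"
    using inj_on_extend by (simp add: bij_betw_def Sym_def Aut_def)
  ultimately show ?thesis by (intro is_isoI isoI)
qed

end

theorem theorem4p21:
  fixes n :: nat and \<M> :: "'a::semigroup_mult set set"
  assumes "n \<ge> 2"
    and "card \<M> = n"
    and "\<forall>I\<in>\<M>. minimal_left_ideal I"
    and "\<Union>\<M> = UNIV"
  shows "Aut (intersection_ideal_graph :: 'a set pair_pre_digraph) \<cong> sym_group n \<and>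
         order (Aut (intersection_ideal_graph :: 'a set pair_pre_digraph)) = fact n"
proof -
  interpret minimal_left_ideal_cover \<M>
    using assms(3,4) by unfold_locales auto
  \<comment> \<open>\<open>card\<close> is 0 on infinite sets, so a positive cardinality forces
    finiteness.\<close>
  have "finite \<M>"
    using assms(1,2) by (intro card_ge_0_finite) simp
  then obtain f where "bij_betw f {1..n} \<M>"
    using ex_bij_betw_nat_finite_1 assms(2) by blast
  from Sym_is_iso[OF this] have "sym_group n \<cong> Sym \<M>"
    by (simp only: Sym_atLeast1_eq_sym_group)
  \<comment> \<open>The chain starts at \<open>sym_group n\<close> because reversing an isomorphism
    requires its source to be a group.\<close>
  then have "sym_group n \<cong> Aut (intersection_ideal_graph :: 'a set pair_pre_digraph)"
    using Sym_iso_Aut by (rule iso_trans)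
  then have iso: "Aut (intersection_ideal_graph :: 'a set pair_pre_digraph) \<cong> sym_group n"
    by (rule group.iso_sym[OF sym_group_is_group])
  then have "order (Aut (intersection_ideal_graph :: 'a set pair_pre_digraph)) = fact n"
    using iso_same_card order_sym_group by (metis order_def)
  with iso show ?thesis by blast
qed

end
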